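(* For every integer $u\ge 1$ there is a polynomial $p_u$ in one variable with real coefficients, of degree at most $u$, such that for all integers $n>u$ the $u$th moment of the linking number of the random link $L_n$ in the grid model is $$E[lk(L_n)^u]=p_u(n).$$ Furthermore, all odd moments vanish: $E[lk(L_n)^u]=0$ for every odd $u$.
   Context: For a positive integer $n$ and permutations $\sigma,\pi\in S_{2n}$, write $\sigma=(x_1,\dots,x_n,x'_1,\dots,x'_n)$ and $\pi=(y_1,\dots,y_n,y'_1,\dots,y'_n)$ in one-line notation (so $x_k=\sigma(k)$, $x'_l=\sigma(n+l)$, $y_k=\pi(k)$, $y'_l=\pi(n+l)$), the indices $k,l\in\{1,\dots,n\}$ being read modulo $n$. The 2-component oriented grid link diagram $L_n^{\sigma,\pi}$ of order $2n$ has as first component the closed polygonal path $(x_1,y_1)\to(x_1,y_2)\to(x_2,y_2)\to(x_2,y_3)\to\cdots\to(x_n,y_n)\to(x_n,y_1)\to(x_1,y_1)$ and as second component the closed polygonal path $(x'_1,y'_1)\to(x'_1,y'_2)\to(x'_2,y'_2)\to\cdots\to(x'_n,y'_n)\to(x'_n,y'_1)\to(x'_1,y'_1)$; vertical edges always cross over horizontal edges. The linking number of an oriented 2-component link diagram is the sum of the crossing signs over all crossings at which the first component crosses under the second. For $L_n^{\sigma,\pi}$ this is $lk(L_n^{\sigma,\pi})=\sum_{k=1}^n\sum_{l=1}^n\varepsilon_{k,l}^{\sigma,\pi}$, where $\varepsilon_{k,l}^{\sigma,\pi}=+1$ if ($x_k<x'_l<x_{k+1}$ and $y'_{l+1}<y_{k+1}<y'_l$)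 or ($x_{k+1}<x'_l<x_k$ and $y'_l<y_{k+1}<y'_{l+1}$); $\varepsilon_{k,l}^{\sigma,\pi}=-1$ if ($x_k<x'_l<x_{k+1}$ and $y'_l<y_{k+1}<y'_{l+1}$) or ($x_{k+1}<x'_l<x_k$ and $y'_{l+1}<y_{k+1}<y'_l$); and $\varepsilon_{k,l}^{\sigma,\pi}=0$ otherwise. The random link $L_n$ in the grid model is $L_n^{\sigma,\pi}$ with $\sigma,\pi\in S_{2n}$ chosen independently and uniformly at random; $lk(L_n)$ is the resulting random variable and $E$ denotes expectation. The zero polynomial is regarded as having degree at most $u$. *)

theory Defs
  imports
    "HOL-Probability.Probability"
    "HOL-Combinatorics.Permutations"
    "HOL-Computational_Algebra.Polynomial"
begin

section \<open>Oriented grid diagrams and the linking number\<close>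

text \<open>
  An oriented edge is a pair (source, target) of integer points in the plane. A 2-component
  oriented grid link diagram is the pair of the edge sets of its two components; no crossing
  data is stored, since vertical edges always pass over horizontal ones.
\<close>

type_synonym point = "int \<times> int"
type_synonym edge = "point \<times> point"
type_synonym grid_diagram = "edge set \<times> edge set"

definition strictly_between :: "int \<Rightarrow> int \<Rightarrow> int \<Rightarrow> bool" where
  "strictly_between a t b \<longleftrightarrow> a < t \<and> t < b \<or> b < t \<and> t < a"

definition crosses_under :: "edge \<Rightarrow> edge \<Rightarrow> bool" where
  "crosses_under e f \<longleftrightarrow> (case (e, f) of (((a, b), (c, d)), ((p, q), (r, s))) \<Rightarrow>
     b = d \<and> p = r \<and> strictly_between a p c \<and> strictly_between q b s)"

text \<open>
  The sign of the crossing at which \<open>f\<close> passes over \<open>e\<close>. A crossing is positive iff the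
  over-strand has to be turned counterclockwise (by less than a half-turn) in order to point
  along the under-strand.
\<close>

definition crossing_sign :: "edge \<Rightarrow> edge \<Rightarrow> int" where
  "crossing_sign f e = (case (f, e) of (((p, q), (r, s)), ((a, b), (c, d))) \<Rightarrow>
     sgn ((r - p) * (d - b) - (s - q) * (c - a)))"

definition linking_number :: "grid_diagram \<Rightarrow> int" where
  "linking_number L =
     (\<Sum>(e, f) \<in> {(e, f). e \<in> fst L \<and> f \<in> snd L \<and> crosses_under e f}. crossing_sign f e)"


section \<open>The diagram of a pair of permutations\<close>

text \<open>The successor in \<open>{1..n}\<close>, read modulo \<open>n\<close>.\<close>

definition cyc_succ :: "nat \<Rightarrow> nat \<Rightarrow> nat" where
  "cyc_succ n k = (if k = n then 1 else Suc k)"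

definition vertical_edge :: "nat \<Rightarrow> (nat \<Rightarrow> int) \<Rightarrow> (nat \<Rightarrow> int) \<Rightarrow> nat \<Rightarrow> edge" where
  "vertical_edge n x y k = ((x k, y k), (x k, y (cyc_succ n k)))"

definition horizontal_edge :: "nat \<Rightarrow> (nat \<Rightarrow> int) \<Rightarrow> (nat \<Rightarrow> int) \<Rightarrow> nat \<Rightarrow> edge" where
  "horizontal_edge n x y k = ((x k, y (cyc_succ n k)), (x (cyc_succ n k), y (cyc_succ n k)))"

text \<open>The closed path \<open>(x 1, y 1) \<rightarrow> (x 1, y 2) \<rightarrow> (x 2, y 2) \<rightarrow> \<dots> \<rightarrow> (x n, y 1) \<rightarrow> (x 1, y 1)\<close>:\<close>

definition grid_component :: "nat \<Rightarrow> (nat \<Rightarrow> int) \<Rightarrow> (nat \<Rightarrow> int) \<Rightarrow> edge set" where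
  "grid_component n x y = vertical_edge n x y ` {1..n} \<union> horizontal_edge n x y ` {1..n}"

definition grid_link :: "nat \<Rightarrow> (nat \<Rightarrow> nat) \<Rightarrow> (nat \<Rightarrow> nat) \<Rightarrow> grid_diagram" where
  "grid_link n \<sigma> \<pi> =
     (grid_component n (\<lambda>k. int (\<sigma> k)) (\<lambda>k. int (\<pi> k)),
      grid_component n (\<lambda>l. int (\<sigma> (n + l))) (\<lambda>l. int (\<pi> (n + l))))"


section \<open>The random link in the grid model\<close>

definition random_grid_link :: "nat \<Rightarrow> grid_diagram pmf" where
  "random_grid_link n =
     map_pmf (\<lambda>(\<sigma>, \<pi>). grid_link n \<sigma> \<pi>)
       (pair_pmf (pmf_of_set {\<sigma>. \<sigma> permutes {1..2 * n}}) (pmf_of_set {\<pi>. \<pi> permutes {1..2 * n}}))"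

definition lk_moment :: "nat \<Rightarrow> nat \<Rightarrow> real" where
  "lk_moment n u =
     measure_pmf.expectation (random_grid_link n) (\<lambda>L. real_of_int (linking_number L) ^ u)"


section \<open>The linking number as an explicit double sum\<close>

definition grid_eps :: "nat \<Rightarrow> (nat \<Rightarrow> nat) \<Rightarrow> (nat \<Rightarrow> nat) \<Rightarrow> nat \<Rightarrow> nat \<Rightarrow> int" where
  "grid_eps n \<sigma> \<pi> k l =
    (let x0 = \<sigma> k; x1 = \<sigma> (cyc_succ n k); x' = \<sigma> (n + l);
         y1 = \<pi> (cyc_succ n k); y0' = \<pi> (n + l); y1' = \<pi> (n + cyc_succ n l)
     in if x0 < x' \<and> x' < x1 \<and> y1' < y1 \<and> y1 < y0' \<or> x1 < x' \<and> x' < x0 \<and> y0' < y1 \<and> y1 < y1' then 1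
        else if x0 < x' \<and> x' < x1 \<and> y0' < y1 \<and> y1 < y1' \<or> x1 < x' \<and> x' < x0 \<and> y1' < y1 \<and> y1 < y0' then -1
        else 0)"

lemma linking_number_grid_link:
  assumes "inj \<sigma>"
  shows "linking_number (grid_link n \<sigma> \<pi>) = (\<Sum>k = 1..n. \<Sum>l = 1..n. grid_eps n \<sigma> \<pi> k l)"
proof -
  define h where "h = horizontal_edge n (\<lambda>k. int (\<sigma> k)) (\<lambda>k. int (\<pi> k))"
  define v where "v = vertical_edge n (\<lambda>l. int (\<sigma> (n + l))) (\<lambda>l. int (\<pi> (n + l)))"
  define P where "P = {(k, l). k \<in> {1..n} \<and> l \<in> {1..n} \<and> crosses_under (h k) (v l)}"
  have eq: "{(e, f). e \<in> fst (grid_link n \<sigma> \<pi>) \<and> f \<in> snd (grid_link n \<sigma> \<pi>) \<and> crosses_under e f}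
      = (\<lambda>(k, l). (h k, v l)) ` P"
    by (auto simp: P_def h_def v_def grid_link_def grid_component_def crosses_under_def
        strictly_between_def vertical_edge_def horizontal_edge_def)
  have inj: "inj_on (\<lambda>(k, l). (h k, v l)) P"
    using assms by (auto simp: inj_on_def h_def v_def vertical_edge_def horizontal_edge_def
        inj_eq[OF assms])
  have sign: "crossing_sign (v l) (h k) = grid_eps n \<sigma> \<pi> k l" if "(k, l) \<in> P" for k l
    using that by (auto simp: P_def h_def v_def crossing_sign_def grid_eps_def Let_def
        crosses_under_def strictly_between_def vertical_edge_def horizontal_edge_def
        sgn_mult)
  have zero: "grid_eps n \<sigma> \<pi> k l = 0" if "(k, l) \<in> {1..n} \<times> {1..n} - P" for k l
    using that by (auto simp: P_def h_def v_def grid_eps_def Let_def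
        crosses_under_def strictly_between_def vertical_edge_def horizontal_edge_def)
  have "linking_number (grid_link n \<sigma> \<pi>) = (\<Sum>(k, l)\<in>P. crossing_sign (v l) (h k))"
    unfolding linking_number_def eq by (subst sum.reindex[OF inj]) (simp add: case_prod_unfold)
  also have "\<dots> = (\<Sum>(k, l)\<in>P. grid_eps n \<sigma> \<pi> k l)"
    by (rule sum.cong) (auto simp: sign)
  also have "\<dots> = (\<Sum>(k, l)\<in>{1..n} \<times> {1..n}. grid_eps n \<sigma> \<pi> k l)"
  proof (rule sum.mono_neutral_left)
    show "P \<subseteq> {1..n} \<times> {1..n}"
      by (auto simp: P_def)
    show "\<forall>i\<in>{1..n} \<times> {1..n} - P. (case i of (k, l) \<Rightarrow> grid_eps n \<sigma> \<pi> k l) = 0"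
    proof
      fix i assume "i \<in> {1..n} \<times> {1..n} - P"
      then show "(case i of (k, l) \<Rightarrow> grid_eps n \<sigma> \<pi> k l) = 0"
        using zero[of "fst i" "snd i"] by (simp add: case_prod_unfold)
    qed
  qed simp
  finally show ?thesis
    by (simp add: sum.cartesian_product)
qed

end

theory Submission
  imports Defs
begin

text \<open>
  Writing \<open>\<epsilon>\<close> as a product of differences of signs in \<open>x\<close> and in \<open>y\<close>, the \<open>u\<close>-th moment is
  a sum over \<open>k, l \<in> {1..n}\<^sup>u\<close> of products of two averages over permutations. Each average depends
  only on which positions coincide, i.e. on which of the equations \<open>k\<^sub>j = k\<^sub>i\<close>, \<open>k\<^sub>j = k\<^sub>i + 1\<close> hold
  modulo \<open>n\<close>, and likewise for \<open>l\<close>. If some \<open>k\<^sub>i\<close> is neither equal nor adjacent to another \<open>k\<^sub>j\<close>,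
  exchanging the values at \<open>k\<^sub>i\<close> and \<open>k\<^sub>i + 1\<close> flips the sign of one factor only, so the \<open>x\<close>-average
  vanishes; the same holds for \<open>l\<close> and the \<open>y\<close>-average. Hence only systems of equations with at most
  \<open>u div 2\<close> connected components contribute. For \<open>n > u\<close> a system with \<open>c\<close> components has \<open>n\<^sup>c\<close>
  solutions or none, uniformly in \<open>n\<close>, and downward induction over the systems turns this into
  polynomial counts of degree at most \<open>u div 2\<close> for those \<open>k\<close> satisfying exactly a given system.
  Reversing the order of the \<open>x\<close>-values shows that the odd moments vanish.
\<close>

section \<open>Averages over permutations\<close>

definition perm_avg :: "nat \<Rightarrow> ((nat \<Rightarrow> nat) \<Rightarrow> real) \<Rightarrow> real" where
  "perm_avg N f = (\<Sum>\<sigma> | \<sigma> permutes {1..N}. f \<sigma>) / fact N"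

lemma perm_avg_compose_right:
  assumes "\<tau> permutes {1..N}"
  shows "perm_avg N (\<lambda>\<sigma>. f (\<sigma> \<circ> \<tau>)) = perm_avg N f"
  unfolding perm_avg_def using sum_permutations_compose_right[OF assms, of f] by simp

lemma perm_avg_compose_left:
  assumes "\<tau> permutes {1..N}"
  shows "perm_avg N (\<lambda>\<sigma>. f (\<tau> \<circ> \<sigma>)) = perm_avg N f"
  unfolding perm_avg_def using setum_permutations_compose_left[OF assms, of f] by simp

lemma perm_avg_cong:
  assumes "\<And>\<sigma>. \<sigma> permutes {1..N} \<Longrightarrow> f \<sigma> = g \<sigma>"
  shows "perm_avg N f = perm_avg N g"
  unfolding perm_avg_def using assms by (auto intro!: sum.cong arg_cong2[of _ _ _ _ "(/)"])

lemma perm_avg_const [simp]: "perm_avg N (\<lambda>_. c) = c"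
  by (simp add: perm_avg_def card_permutations)

lemma perm_avg_minus: "perm_avg N (\<lambda>\<sigma>. - f \<sigma>) = - perm_avg N f"
  by (simp add: perm_avg_def sum_negf)

lemma perm_avg_swap:
  "perm_avg M (\<lambda>\<sigma>. perm_avg N (f \<sigma>)) = perm_avg N (\<lambda>\<tau>. perm_avg M (\<lambda>\<sigma>. f \<sigma> \<tau>))"
  unfolding perm_avg_def sum_divide_distrib
  by (subst sum.swap) (simp add: mult.commute)

lemma perm_avg_sum: "perm_avg N (\<lambda>\<sigma>. \<Sum>x\<in>A. f x \<sigma>) = (\<Sum>x\<in>A. perm_avg N (f x))"
  unfolding perm_avg_def by (subst sum.swap) (simp add: sum_divide_distrib)

lemma perm_avg_cmult: "perm_avg N (\<lambda>\<sigma>. c * f \<sigma>) = c * perm_avg N f"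
  by (simp add: perm_avg_def sum_distrib_left)

lemma perm_avg_mult_const: "perm_avg N (\<lambda>\<sigma>. f \<sigma> * c) = perm_avg N f * c"
  by (simp add: perm_avg_def sum_distrib_right)

text \<open>Replacing \<sigma> by \<open>\<sigma> \<circ> \<tau>\<close> permutes the summands and
  negates exactly one factor, so the average equals its own negative.\<close>

lemma perm_avg_prod_eq_0:
  assumes "\<tau> permutes {1..N}" "finite A" "i \<in> A"
    and neg: "\<And>\<sigma>. F (\<sigma> \<circ> \<tau>) i = - F \<sigma> i"
    and inv: "\<And>\<sigma> j. j \<in> A \<Longrightarrow> j \<noteq> i \<Longrightarrow> F (\<sigma> \<circ> \<tau>) j = F \<sigma> j"
  shows "perm_avg N (\<lambda>\<sigma>. \<Prod>j\<in>A. F \<sigma> j) = 0"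
proof -
  have "(\<Prod>j\<in>A. F (\<sigma> \<circ> \<tau>) j) = - (\<Prod>j\<in>A. F \<sigma> j)" for \<sigma>
    using assms(2,3) neg inv by (simp add: prod.remove)
  then have "perm_avg N (\<lambda>\<sigma>. \<Prod>j\<in>A. F \<sigma> j) = - perm_avg N (\<lambda>\<sigma>. \<Prod>j\<in>A. F \<sigma> j)"
    unfolding perm_avg_minus[symmetric]
    by (subst perm_avg_compose_right[OF assms(1), symmetric]) simp
  then show ?thesis by simp
qed

section \<open>Functions of the relative order of the values\<close>

definition order_invariant_on :: "'a set \<Rightarrow> (('a \<Rightarrow> nat) \<Rightarrow> real) \<Rightarrow> bool" where
  "order_invariant_on I g \<longleftrightarrow>
     (\<forall>v w. (\<forall>a\<in>I. \<forall>b\<in>I. v a < v b \<longleftrightarrow> w a < w b) \<longrightarrow> g v = g w)"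

lemma order_invariant_onD:
  assumes "order_invariant_on I g" "\<And>a b. a \<in> I \<Longrightarrow> b \<in> I \<Longrightarrow> v a < v b \<longleftrightarrow> w a < w b"
  shows "g v = g w"
  using assms unfolding order_invariant_on_def by blast

lemma ex_order_isomorphic_permutation:
  fixes w :: "nat \<Rightarrow> nat"
  assumes "inj_on w {1..m}"
  obtains \<rho> where "\<rho> permutes {1..m}"
    "\<And>i j. i \<in> {1..m} \<Longrightarrow> j \<in> {1..m} \<Longrightarrow> \<rho> i < \<rho> j \<longleftrightarrow> w i < w j"
proof -
  \<comment> \<open>The rank of \<open>w i\<close> among the values; counting with \<le> makes ranks
    start at 1, as \<open>{1..m}\<close> demands.\<close>
  define r where "r i = card {j \<in> {1..m}. w j \<le> w i}" for i
  define \<rho> where "\<rho> i = (if i \<in> {1..m} then r i else i)" for i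
  have less: "r i < r j" if "i \<in> {1..m}" "j \<in> {1..m}" "w i < w j" for i j
  proof -
    have "j \<in> {j' \<in> {1..m}. w j' \<le> w j} - {j \<in> {1..m}. w j \<le> w i}"
      using that by auto
    moreover have "{j \<in> {1..m}. w j \<le> w i} \<subseteq> {j' \<in> {1..m}. w j' \<le> w j}"
      using that by auto
    ultimately show ?thesis
      unfolding r_def by (intro psubset_card_mono) auto
  qed
  have iff: "\<rho> i < \<rho> j \<longleftrightarrow> w i < w j" if "i \<in> {1..m}" "j \<in> {1..m}" for i j
    using less[of i j] less[of j i] inj_onD[OF assms, of i j] that
    by (cases "w i" "w j" rule: linorder_cases) (auto simp: \<rho>_def)
  have inj: "inj_on \<rho> {1..m}"
    by (rule inj_onI) (metis iff inj_onD[OF assms] linorder_neq_iff)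
  have "r i \<in> {1..m}" if "i \<in> {1..m}" for i
  proof -
    have "r i \<le> card {1..m}"
      unfolding r_def by (rule card_mono) auto
    moreover have "r i > 0"
      unfolding r_def using that by (auto simp: card_gt_0_iff)
    ultimately show ?thesis by simp
  qed
  then have "\<rho> permutes {1..m}"
    by (intro inj_imp_permutes[OF inj]) (simp_all add: \<rho>_def del: atLeastAtMost_iff)
  with iff show ?thesis
    using that by blast
qed

text \<open>Averaging over the rearrangements of the \<open>m\<close> chosen positions leaves only the relative order of
  the values, which is then uniform whatever the values are.\<close>

lemma perm_avg_order_invariant_injection:
  assumes h: "order_invariant_on {1..m} h"
    and q: "inj_on q {1..m}" "q ` {1..m} \<subseteq> {1..N}"
  shows "perm_avg N (\<lambda>\<sigma>. h (\<sigma> \<circ> q)) = perm_avg m h"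
proof -
  have conj: "perm_avg N (\<lambda>\<sigma>. h (\<sigma> \<circ> q)) = perm_avg N (\<lambda>\<sigma>. h (\<sigma> \<circ> q \<circ> \<tau>))"
    if \<tau>: "\<tau> permutes {1..m}" for \<tau>
  proof -
    \<comment> \<open>Transports \<tau> along \<open>q\<close> to the chosen positions and fixes all
      others.\<close>
    define \<tau>' where "\<tau>' = map_permutation {1..m} q \<tau>"
    have "\<tau>' permutes {1..N}"
      unfolding \<tau>'_def using q \<tau>
      by (meson inj_on_imp_bij_betw map_permutation_permutes permutes_subset)
    then have "perm_avg N (\<lambda>\<sigma>. h (\<sigma> \<circ> q)) = perm_avg N (\<lambda>\<sigma>. h (\<sigma> \<circ> \<tau>' \<circ> q))"
      by (rule perm_avg_compose_right[symmetric])
    also have "\<dots> = perm_avg N (\<lambda>\<sigma>. h (\<sigma> \<circ> q \<circ> \<tau>))"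
    proof (rule perm_avg_cong, rule order_invariant_onD[OF h])
      fix \<sigma> a b assume "a \<in> {1..m}" "b \<in> {1..m}"
      moreover have "\<tau>' (q i) = q (\<tau> i)" if "i \<in> {1..m}" for i
        unfolding \<tau>'_def using q(1) that by (simp add: map_permutation_apply)
      ultimately show "(\<sigma> \<circ> \<tau>' \<circ> q) a < (\<sigma> \<circ> \<tau>' \<circ> q) b \<longleftrightarrow> (\<sigma> \<circ> q \<circ> \<tau>) a < (\<sigma> \<circ> q \<circ> \<tau>) b"
        by simp
    qed
    finally show ?thesis .
  qed
  \<comment> \<open>For fixed \<sigma> the values \<open>\<sigma> \<circ> q\<close> compare like a
    permutation \<rho>, and \<open>\<rho> \<circ> \<tau>\<close> runs over all permutations of
    \<open>{1..m}\<close> as \<tau> does.\<close>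
  have avg: "perm_avg m (\<lambda>\<tau>. h (\<sigma> \<circ> q \<circ> \<tau>)) = perm_avg m h" if \<sigma>: "\<sigma> permutes {1..N}" for \<sigma>
  proof -
    have "inj_on (\<sigma> \<circ> q) {1..m}"
      using q(1) permutes_inj_on[OF \<sigma>] by (rule comp_inj_on)
    then obtain \<rho> where \<rho>: "\<rho> permutes {1..m}"
      "\<And>i j. i \<in> {1..m} \<Longrightarrow> j \<in> {1..m} \<Longrightarrow> \<rho> i < \<rho> j \<longleftrightarrow> (\<sigma> \<circ> q) i < (\<sigma> \<circ> q) j"
      by (rule ex_order_isomorphic_permutation) blast
    have "perm_avg m (\<lambda>\<tau>. h (\<sigma> \<circ> q \<circ> \<tau>)) = perm_avg m (\<lambda>\<tau>. h (\<rho> \<circ> \<tau>))"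
    proof (rule perm_avg_cong, rule order_invariant_onD[OF h])
      fix \<tau> a b assume "\<tau> permutes {1..m}" "a \<in> {1..m}" "b \<in> {1..m}"
      then show "(\<sigma> \<circ> q \<circ> \<tau>) a < (\<sigma> \<circ> q \<circ> \<tau>) b \<longleftrightarrow> (\<rho> \<circ> \<tau>) a < (\<rho> \<circ> \<tau>) b"
        using \<rho>(2)[of "\<tau> a" "\<tau> b"] permutes_in_image[of \<tau> "{1..m}"] by simp
    qed
    then show ?thesis
      using perm_avg_compose_left[OF \<rho>(1)] by simp
  qed
  have "perm_avg N (\<lambda>\<sigma>. h (\<sigma> \<circ> q)) = perm_avg m (\<lambda>\<tau>. perm_avg N (\<lambda>\<sigma>. h (\<sigma> \<circ> q)))"
    by simp
  also have "\<dots> = perm_avg m (\<lambda>\<tau>. perm_avg N (\<lambda>\<sigma>. h (\<sigma> \<circ> q \<circ> \<tau>)))"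
    by (rule perm_avg_cong) (rule conj)
  also have "\<dots> = perm_avg N (\<lambda>\<sigma>. perm_avg m (\<lambda>\<tau>. h (\<sigma> \<circ> q \<circ> \<tau>)))"
    by (rule perm_avg_swap)
  also have "\<dots> = perm_avg N (\<lambda>\<sigma>. perm_avg m h)"
    by (rule perm_avg_cong) (rule avg)
  finally show ?thesis by simp
qed

text \<open>Both averages equal one over the permutations of \<open>{1..m}\<close>, where
  \<open>m\<close> counts the distinct positions: by \<open>ker\<close>, both position maps factor
  through the same labelling of coincidence classes.\<close>

lemma perm_avg_order_invariant_eq:
  assumes I: "finite I" and g: "order_invariant_on I g"
    and p: "p ` I \<subseteq> {1..N}" and p': "p' ` I \<subseteq> {1..N'}"
    and ker: "\<And>a b. a \<in> I \<Longrightarrow> b \<in> I \<Longrightarrow> p a = p b \<longleftrightarrow> p' a = p' b"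
  shows "perm_avg N (\<lambda>\<sigma>. g (\<sigma> \<circ> p)) = perm_avg N' (\<lambda>\<sigma>. g (\<sigma> \<circ> p'))"
proof -
  obtain q where q: "bij_betw q {1..card (p ` I)} (p ` I)"
    using I ex_bij_betw_nat_finite_1 by blast
  define m where "m = card (p ` I)"
  \<comment> \<open>\<open>c\<close> numbers the distinct positions and \<open>t\<close> carries
    \<open>p a\<close> to \<open>p' a\<close>; the two directions of \<open>ker\<close> make
    \<open>t\<close> well defined and injective.\<close>
  define c where "c = inv_into {1..m} q \<circ> p"
  define t where "t = p' \<circ> inv_into I p"
  note q = q[folded m_def]
  have c: "c a \<in> {1..m}" "q (c a) = p a" if "a \<in> I" for a
    using that q by (auto simp: c_def bij_betw_def f_inv_into_f intro: inv_into_into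
        simp del: atLeastAtMost_iff)
  have t: "t (p a) = p' a" if "a \<in> I" for a
  proof -
    have "inv_into I p (p a) \<in> I" "p (inv_into I p (p a)) = p a"
      using that by (auto intro: inv_into_into f_inv_into_f)
    with ker[OF this(1) that] show ?thesis
      by (simp add: t_def)
  qed
  have inj_t: "inj_on t (p ` I)"
    using t ker by (auto intro!: inj_onI)
  have h: "order_invariant_on {1..m} (\<lambda>w. g (w \<circ> c))"
    unfolding order_invariant_on_def comp_def
    by (intro allI impI order_invariant_onD[OF g]) (blast dest: c(1))
  have "perm_avg N (\<lambda>\<sigma>. g (\<sigma> \<circ> p)) = perm_avg N (\<lambda>\<sigma>. g (\<sigma> \<circ> q \<circ> c))"
    by (intro perm_avg_cong order_invariant_onD[OF g]) (simp add: c)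
  also have "\<dots> = perm_avg m (\<lambda>w. g (w \<circ> c))"
    using perm_avg_order_invariant_injection[OF h, of q N] q p by (auto simp: bij_betw_def)
  also have "\<dots> = perm_avg N' (\<lambda>\<sigma>. g (\<sigma> \<circ> (t \<circ> q) \<circ> c))"
  proof (rule perm_avg_order_invariant_injection[OF h, symmetric])
    show "inj_on (t \<circ> q) {1..m}"
      using q inj_t by (auto simp: bij_betw_def intro: comp_inj_on)
    show "(t \<circ> q) ` {1..m} \<subseteq> {1..N'}"
    proof -
      have "(t \<circ> q) ` {1..m} = t ` p ` I"
        by (simp only: image_comp[symmetric] bij_betw_imp_surj_on[OF q])
      also have "\<dots> = p' ` I"
        using t by (simp add: image_image)
      finally show ?thesis
        using p' by simp
    qed
  qed
  also have "\<dots> = perm_avg N' (\<lambda>\<sigma>. g (\<sigma> \<circ> p'))"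
    by (intro perm_avg_cong order_invariant_onD[OF g]) (simp add: c t)
  finally show ?thesis .
qed

section \<open>Counting solutions of adjacency systems\<close>

definition step :: "nat \<Rightarrow> bool \<Rightarrow> nat \<Rightarrow> nat" where
  "step n s a = (if s then cyc_succ n a else a)"

text \<open>Encoding the coincidences as a set lets partial and exact systems be compared by
  inclusion.\<close>

definition adjacency :: "nat \<Rightarrow> nat \<Rightarrow> (nat \<Rightarrow> nat) \<Rightarrow> (nat \<times> nat \<times> bool) set" where
  "adjacency n u k = {(i, j, s). i < u \<and> j < u \<and> k j = step n s (k i)}"

text \<open>In the graph with an edge for each equation no vertex is isolated. The condition
  \<open>j \<noteq> i\<close> discards the loops \<open>(i, i, False)\<close>, which every adjacency
  system contains.\<close>

definition linked :: "nat \<Rightarrow> (nat \<times> nat \<times> bool) set \<Rightarrow> bool" where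
  "linked u T \<longleftrightarrow> (\<forall>i<u. \<exists>j<u. j \<noteq> i \<and> (\<exists>s. (i, j, s) \<in> T \<or> (j, i, s) \<in> T))"

lemma linked_mono: "linked u S \<Longrightarrow> S \<subseteq> T \<Longrightarrow> linked u T"
  unfolding linked_def by (meson subsetD)

lemma adjacency_subset: "adjacency n u k \<subseteq> {..<u} \<times> {..<u} \<times> UNIV"
  by (auto simp: adjacency_def)

text \<open>Such a function is a free choice of one value per class of indices; linkedness puts at
  least two indices into each class, which bounds the number \<open>c\<close> of classes.\<close>

lemma card_PiE_constant_on_classes:
  fixes u n :: nat
  assumes T: "T \<subseteq> {..<u} \<times> {..<u} \<times> UNIV" and "linked u T"
  shows "\<exists>c \<le> u div 2. \<forall>n. card {f \<in> {..<u} \<rightarrow>\<^sub>E {1..n::nat}. \<forall>(i, j, s)\<in>T. f j = f i} = n ^ c"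
proof -
  define resp where "resp f \<longleftrightarrow> (\<forall>(i, j, s)\<in>T. f j = f i)" for f :: "nat \<Rightarrow> nat"
  \<comment> \<open>On indices this is the equivalence relation generated by \<open>T\<close>:
    indicators of its classes respect \<open>T\<close>, so nothing more is identified. Quantifying
    over functions avoids building a closure.\<close>
  define R where "R i j \<longleftrightarrow> (\<forall>f. resp f \<longrightarrow> f i = f j)" for i j
  define r where "r i = (LEAST j. j < u \<and> R i j)" for i
  have r: "r i < u" "R i (r i)" if "i < u" for i
    using LeastI[of "\<lambda>j. j < u \<and> R i j" i] that by (auto simp: r_def R_def)
  have r_eq: "r i = r j" if "R i j" for i j
  proof -
    have "R i = R j"
      using that unfolding R_def fun_eq_iff by metis
    then show ?thesis by (simp add: r_def)
  qed
  have r_T: "r i = r j" if "(i, j, s) \<in> T" for i j s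
    by (rule r_eq) (use that in \<open>force simp: R_def resp_def\<close>)
  have resp_r: "f (r i) = f i" if "resp f" "i < u" for f i
    using r(2)[OF that(2)] that(1) unfolding R_def by metis
  have r_r: "r (r i) = r i" if "i < u" for i
    using r_eq[OF r(2)[OF that]] by simp
  define c where "c = card (r ` {..<u})"
  have sub: "r ` {..<u} \<subseteq> {..<u}"
    using r by auto
  have fiber: "2 \<le> card {i \<in> {..<u}. r i = a}" if "a \<in> r ` {..<u}" for a
  proof -
    from that obtain i where i: "i < u" "a = r i"
      by blast
    then obtain j where j: "j < u" "j \<noteq> i" "r i = r j"
      using assms(2) r_T unfolding linked_def by metis
    have "card {i, j} \<le> card {i \<in> {..<u}. r i = a}"
      by (rule card_mono) (use i j in auto)
    then show ?thesis
      using j by simp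
  qed
  have "2 * c = (\<Sum>a\<in>r ` {..<u}. 2)"
    by (simp add: c_def)
  also have "\<dots> \<le> (\<Sum>a\<in>r ` {..<u}. card {i \<in> {..<u}. r i = a})"
    by (rule sum_mono) (rule fiber)
  also have "\<dots> = card {..<u}"
    using sum_fun_comp[of "{..<u}" "r ` {..<u}" r "\<lambda>_. 1 :: nat"]
    by simp
  finally have "c \<le> u div 2"
    by simp
  moreover have "card {f \<in> {..<u} \<rightarrow>\<^sub>E {1..n::nat}. resp f} = n ^ c" for n
  proof -
    \<comment> \<open>A function constant on classes is recovered from its values at the
      representatives by composing with \<open>r\<close>.\<close>
    have "bij_betw (\<lambda>f. restrict f (r ` {..<u})) {f \<in> {..<u} \<rightarrow>\<^sub>E {1..n::nat}. resp f}
        (r ` {..<u} \<rightarrow>\<^sub>E {1..n})"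
    proof (rule bij_betw_byWitness[where f' = "\<lambda>g. restrict (g \<circ> r) {..<u}"])
      show "\<forall>f\<in>{f \<in> {..<u} \<rightarrow>\<^sub>E {1..n}. resp f}.
          restrict (restrict f (r ` {..<u}) \<circ> r) {..<u} = f"
      proof
        fix f assume f: "f \<in> {f \<in> {..<u} \<rightarrow>\<^sub>E {1..n}. resp f}"
        then have "f \<in> {..<u} \<rightarrow>\<^sub>E {1..n}" "resp f"
          by blast+
        then show "restrict (restrict f (r ` {..<u}) \<circ> r) {..<u} = f"
          using resp_r[of f] PiE_arb[of f "{..<u}" "\<lambda>_. {1..n}"]
          by (intro ext) (simp add: restrict_def)
      qed
      show "\<forall>g\<in>r ` {..<u} \<rightarrow>\<^sub>E {1..n}. restrict (restrict (g \<circ> r) {..<u}) (r ` {..<u}) = g"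
      proof
        fix g assume g: "g \<in> r ` {..<u} \<rightarrow>\<^sub>E {1..n}"
        show "restrict (restrict (g \<circ> r) {..<u}) (r ` {..<u}) = g"
        proof
          fix x show "restrict (restrict (g \<circ> r) {..<u}) (r ` {..<u}) x = g x"
          proof (cases "x \<in> r ` {..<u}")
            case True
            then have "r x = x" "x < u"
              using r_r r by auto
            with True show ?thesis by simp
          next
            case False
            then show ?thesis
              using PiE_arb[OF g] by simp
          qed
        qed
      qed
      show "(\<lambda>f. restrict f (r ` {..<u})) ` {f \<in> {..<u} \<rightarrow>\<^sub>E {1..n}. resp f}
          \<subseteq> r ` {..<u} \<rightarrow>\<^sub>E {1..n}"
        using sub by (intro image_subsetI, unfold PiE_iff extensional_def) (simp, blast)
      show "(\<lambda>g. restrict (g \<circ> r) {..<u}) ` (r ` {..<u} \<rightarrow>\<^sub>E {1..n})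
          \<subseteq> {f \<in> {..<u} \<rightarrow>\<^sub>E {1..n}. resp f}"
      proof (intro image_subsetI CollectI conjI)
        fix g assume g: "g \<in> r ` {..<u} \<rightarrow>\<^sub>E {1..n}"
        show "restrict (g \<circ> r) {..<u} \<in> {..<u} \<rightarrow>\<^sub>E {1..n}"
          by (intro restrict_PiE_iff[THEN iffD2] ballI) (use g PiE_mem[OF g] in simp)
        show "resp (restrict (g \<circ> r) {..<u})"
          using T r_T by (fastforce simp: resp_def)
      qed
    qed
    then show ?thesis
      using bij_betw_same_card by (fastforce simp: c_def card_PiE)
  qed
  ultimately show ?thesis
    unfolding resp_def by blast
qed

section \<open>Residues in \<open>{1..n}\<close> and solutions from a potential\<close>

definition residue :: "nat \<Rightarrow> int \<Rightarrow> nat" where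
  "residue n x = nat ((x - 1) mod int n) + 1"

lemma residue_range: "n > 0 \<Longrightarrow> residue n x \<in> {1..n}"
  using pos_mod_bound[of "int n" "x - 1"] by (auto simp: residue_def Suc_le_eq nat_less_iff)

lemma residue_eq_iff: "n > 0 \<Longrightarrow> residue n x = residue n y \<longleftrightarrow> x mod int n = y mod int n"
  by (simp add: residue_def eq_nat_nat_iff mod_eq_dvd_iff)

lemma residue_of_nat: "a \<in> {1..n} \<Longrightarrow> residue n (int a) = a"
  by (auto simp: residue_def)

lemma of_nat_residue_mod: "n > 0 \<Longrightarrow> int (residue n x) mod int n = x mod int n"
  by (simp add: residue_def mod_simps)

text \<open>With representatives 1 to \<open>n\<close> instead of 0 to \<open>n - 1\<close>, the
  cyclic successor is plain addition of 1 modulo \<open>n\<close>.\<close>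

lemma cyc_succ_eq_residue: "a \<in> {1..n} \<Longrightarrow> cyc_succ n a = residue n (int a + 1)"
  by (auto simp: residue_def cyc_succ_def)

lemma step_eq_residue: "a \<in> {1..n} \<Longrightarrow> step n s a = residue n (int a + of_bool s)"
  by (simp add: step_def cyc_succ_eq_residue residue_of_nat)

lemma residue_shift: "n > 0 \<Longrightarrow> residue n (int (residue n x) + y) = residue n (x + y)"
  by (metis mod_add_left_eq of_nat_residue_mod residue_eq_iff)

text \<open>Subtracting the potential \<open>h\<close> modulo \<open>n\<close> turns each equation
  \<open>k j = k i + s\<close> into \<open>f j = f i\<close>; adding it back is the inverse.\<close>

lemma card_adjacency_superset_potential:
  fixes h :: "nat \<Rightarrow> int"
  assumes T: "T \<subseteq> {..<u} \<times> {..<u} \<times> UNIV" and n: "n > 0"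
    and h: "\<And>i j s. (i, j, s) \<in> T \<Longrightarrow> h j = h i + of_bool s"
  shows "card {k \<in> {..<u} \<rightarrow>\<^sub>E {1..n}. T \<subseteq> adjacency n u k}
       = card {f \<in> {..<u} \<rightarrow>\<^sub>E {1..n}. \<forall>(i, j, s)\<in>T. f j = f i}"
proof (rule bij_betw_same_card)
  \<comment> \<open>The potential is a parameter here because the shifts by \<open>h\<close> and by
    \<open>- h\<close> are both used; values outside \<open>{..<u}\<close> stay undefined to remain
    extensional.\<close>
  define shift where "shift h f = (\<lambda>i\<in>{..<u}. residue n (int (f i) + h i))"
    for h :: "nat \<Rightarrow> int" and f
  have inv: "shift h (shift h' f) = f"
    if f: "f \<in> {..<u} \<rightarrow>\<^sub>E {1..n}" and hh': "\<And>i. h i + h' i = 0" for f h h'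
  proof
    fix i
    have "residue n (int (residue n (int (f i) + h' i)) + h i) = f i" if i: "i < u"
    proof -
      have "f i \<in> {1..n}"
        using PiE_mem[OF f] i by (simp del: atLeastAtMost_iff)
      moreover have "int (f i) + h' i + h i = int (f i)"
        using hh'[of i] by simp
      ultimately show ?thesis
        by (simp only: residue_shift[OF n] residue_of_nat)
    qed
    then show "shift h (shift h' f) i = f i"
      using PiE_arb[OF f, of i] by (cases "i < u") (auto simp: shift_def)
  qed
  have shift_PiE: "shift h f \<in> {..<u} \<rightarrow>\<^sub>E {1..n}" for h f
    unfolding shift_def using residue_range[OF n] by (intro restrict_PiE_iff[THEN iffD2] ballI)
  have eq: "shift h f j = residue n (int (f j) + h j)" if "j < u" for h f j
    using that by (simp add: shift_def)
  show "bij_betw (shift (\<lambda>i. - h i)) {k \<in> {..<u} \<rightarrow>\<^sub>E {1..n}. T \<subseteq> adjacency n u k}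
     {f \<in> {..<u} \<rightarrow>\<^sub>E {1..n}. \<forall>(i, j, s)\<in>T. f j = f i}"
  proof (rule bij_betw_byWitness[where f' = "shift h"])
    show "shift (\<lambda>i. - h i) ` {k \<in> {..<u} \<rightarrow>\<^sub>E {1..n}. T \<subseteq> adjacency n u k}
        \<subseteq> {f \<in> {..<u} \<rightarrow>\<^sub>E {1..n}. \<forall>(i, j, s)\<in>T. f j = f i}"
    proof (intro image_subsetI CollectI conjI shift_PiE ballI, clarify)
      fix k i j s assume k: "k \<in> {..<u} \<rightarrow>\<^sub>E {1..n}" "T \<subseteq> adjacency n u k" and ij: "(i, j, s) \<in> T"
      have ij': "i < u" "j < u" "k i \<in> {1..n}"
        using ij T k(1) by auto
      have "k j = residue n (int (k i) + of_bool s)"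
        using k(2) ij step_eq_residue[OF ij'(3)] by (auto simp: adjacency_def)
      then have "residue n (int (k j) - h j) = residue n (int (k i) + of_bool s + - h j)"
        by (simp only: diff_conv_add_uminus residue_shift[OF n])
      also have "int (k i) + of_bool s + - h j = int (k i) - h i"
        using h[OF ij] by linarith
      finally have "residue n (int (k j) - h j) = residue n (int (k i) - h i)" .
      then show "shift (\<lambda>i. - h i) k j = shift (\<lambda>i. - h i) k i"
        using ij' by (simp add: eq)
    qed
    show "shift h ` {f \<in> {..<u} \<rightarrow>\<^sub>E {1..n}. \<forall>(i, j, s)\<in>T. f j = f i}
        \<subseteq> {k \<in> {..<u} \<rightarrow>\<^sub>E {1..n}. T \<subseteq> adjacency n u k}"
    proof (intro image_subsetI CollectI conjI shift_PiE subsetI)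
      fix f x assume f: "f \<in> {f \<in> {..<u} \<rightarrow>\<^sub>E {1..n}. \<forall>(i, j, s)\<in>T. f j = f i}" and x: "x \<in> T"
      obtain i j s where ij: "x = (i, j, s)"
        by (cases x)
      have ij': "i < u" "j < u"
        using ij T x by auto
      have "shift h f i \<in> {1..n}"
        using PiE_mem[OF shift_PiE] ij'(1) by blast
      then have "step n s (shift h f i) = residue n (int (shift h f i) + of_bool s)"
        by (rule step_eq_residue)
      also have "\<dots> = residue n (int (f i) + h i + of_bool s)"
        using ij' by (simp add: eq residue_shift[OF n])
      also have "int (f i) + h i + of_bool s = int (f j) + h j"
      proof -
        have "f j = f i"
          using f x ij by fast
        then show ?thesis
          using h[of i j s] x ij by simp
      qed
      also have "residue n \<dots> = shift h f j"
        using ij' by (simp add: eq)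
      finally show "x \<in> adjacency n u (shift h f)"
        using ij ij' by (simp add: adjacency_def)
    qed
    show "\<forall>k\<in>{k \<in> {..<u} \<rightarrow>\<^sub>E {1..n}. T \<subseteq> adjacency n u k}. shift h (shift (\<lambda>i. - h i) k) = k"
      using inv[of _ h "\<lambda>i. - h i"] by simp
    show "\<forall>f\<in>{f \<in> {..<u} \<rightarrow>\<^sub>E {1..n}. \<forall>(i, j, s)\<in>T. f j = f i}.
        shift (\<lambda>i. - h i) (shift h f) = f"
      using inv[of _ "\<lambda>i. - h i" h] by simp
  qed
qed

text \<open>As \<open>k\<close> takes at most \<open>u < n\<close> values, the cycle can be cut at a point \<open>z\<close> that \<open>k\<close> avoids,
  so that the successor modulo \<open>n\<close> becomes the integer successor.\<close>

lemma ex_potential: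
  assumes k: "k \<in> {..<u} \<rightarrow>\<^sub>E {1..n}" and n: "n > u" and T: "T \<subseteq> adjacency n u k"
  shows "\<exists>h :: nat \<Rightarrow> int. \<forall>i j s. (i, j, s) \<in> T \<longrightarrow> h j = h i + of_bool s"
proof -
  have "card (k ` {..<u}) \<le> u"
    using card_image_le[of "{..<u}" k] by simp
  then have "\<not> {1..n} \<subseteq> k ` {..<u}"
    using card_mono[of "k ` {..<u}" "{1..n}"] n by auto
  then obtain z where z: "z \<in> {1..n}" "z \<notin> k ` {..<u}"
    by blast
  \<comment> \<open>The distance from \<open>z\<close> to \<open>k i\<close> in the direction of the
    cycle.\<close>
  define h where "h i = (int (k i) - int z) mod int n" for i
  have "h j = h i + of_bool s" if "(i, j, s) \<in> T" for i j s
  proof -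
    have ij: "i < u" "j < u" "k j = step n s (k i)"
      using that T by (auto simp: adjacency_def)
    have kij: "k i \<in> {1..n}" "k j \<in> {1..n}"
      using PiE_mem[OF k] ij(1,2) by (simp_all del: atLeastAtMost_iff)
    show ?thesis
    proof (cases s)
      case False
      then show ?thesis
        using ij by (simp add: h_def step_def)
    next
      case True
      \<comment> \<open>Adding 1 modulo \<open>n\<close> wraps around only onto 0, and distance 0
        would mean \<open>k j = z\<close>.\<close>
      have "h j \<noteq> 0"
      proof
        assume "h j = 0"
        then have "int (k j) mod int n = int z mod int n"
          by (simp add: h_def mod_eq_dvd_iff dvd_eq_mod_eq_0)
        then have "k j = z"
          using residue_eq_iff[of n "int (k j)" "int z"] residue_of_nat[OF kij(2)]
            residue_of_nat[OF z(1)] n by simp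
        with z(2) ij(2) show False by blast
      qed
      have "int (k j) mod int n = (int (k i) + 1) mod int n"
        using ij True cyc_succ_eq_residue[OF kij(1)] of_nat_residue_mod[of n] n
        by (simp add: step_def)
      then have "h j = (int (k i) + 1 - int z) mod int n"
        unfolding h_def by (rule mod_diff_cong) simp
      also have "\<dots> = (h i + 1) mod int n"
        unfolding h_def by (simp add: mod_simps algebra_simps)
      finally have hj: "h j = (h i + 1) mod int n" .
      have "0 \<le> h i" "h i < int n"
        using n by (auto simp: h_def)
      then have "h j = h i + 1"
        using hj \<open>h j \<noteq> 0\<close> by (cases "h i + 1 = int n") auto
      then show ?thesis
        using True by simp
    qed
  qed
  then show ?thesis by blast
qed

text \<open>Whether \<open>T\<close> has a potential does not depend on \<open>n\<close>, so one
  polynomial serves all \<open>n > u\<close>: a monomial if there is a potential, zero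
  otherwise.\<close>

lemma card_adjacency_superset_poly:
  assumes T: "T \<subseteq> {..<u} \<times> {..<u} \<times> UNIV" and "linked u T"
  shows "\<exists>p :: real poly. degree p \<le> u div 2 \<and>
    (\<forall>n>u. real (card {k \<in> {..<u} \<rightarrow>\<^sub>E {1..n}. T \<subseteq> adjacency n u k}) = poly p (real n))"
proof (cases "\<exists>h :: nat \<Rightarrow> int. \<forall>i j s. (i, j, s) \<in> T \<longrightarrow> h j = h i + of_bool s")
  case True
  obtain c where "c \<le> u div 2"
    "\<And>n. card {f \<in> {..<u} \<rightarrow>\<^sub>E {1..n::nat}. \<forall>(i, j, s)\<in>T. f j = f i} = n ^ c"
    using card_PiE_constant_on_classes[OF assms] by blast
  moreover from True obtain h :: "nat \<Rightarrow> int"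
    where "\<And>i j s. (i, j, s) \<in> T \<Longrightarrow> h j = h i + of_bool s"
    by blast
  note card_adjacency_superset_potential[OF T _ this]
  ultimately have "card {k \<in> {..<u} \<rightarrow>\<^sub>E {1..n}. T \<subseteq> adjacency n u k} = n ^ c" if "n > u" for n
    using that by simp
  with \<open>c \<le> u div 2\<close> show ?thesis
    by (intro exI[of _ "monom 1 c"]) (simp add: poly_monom degree_monom_eq)
next
  case False
  then have "{k \<in> {..<u} \<rightarrow>\<^sub>E {1..n}. T \<subseteq> adjacency n u k} = {}" if "n > u" for n
    using ex_potential that by blast
  then show ?thesis
    by (intro exI[of _ 0]) (simp del: Collect_empty_eq)
qed

text \<open>Solutions of \<open>T\<close> split by the exact system they satisfy. Strictly larger
  systems are still linked and miss fewer triples, so by induction their counts are known and can be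
  subtracted.\<close>

lemma card_adjacency_eq_poly:
  assumes "T \<subseteq> {..<u} \<times> {..<u} \<times> UNIV" and "linked u T"
  shows "\<exists>p :: real poly. degree p \<le> u div 2 \<and>
    (\<forall>n>u. real (card {k \<in> {..<u} \<rightarrow>\<^sub>E {1..n}. adjacency n u k = T}) = poly p (real n))"
  using assms
proof (induction "card ({..<u} \<times> {..<u} \<times> (UNIV :: bool set) - T)" arbitrary: T rule: less_induct)
  case less
  let ?E = "{..<u} \<times> {..<u} \<times> (UNIV :: bool set)"
  let ?N = "\<lambda>n T. card {k \<in> {..<u} \<rightarrow>\<^sub>E {1..n}. adjacency n u k = T}"
  let ?U = "{S. T \<subset> S \<and> S \<subseteq> ?E}"
  have fin: "finite ?E"
    by simp
  have finU: "finite ?U"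
    by (rule finite_subset[of _ "Pow ?E"]) auto
  have "\<exists>p :: real poly. degree p \<le> u div 2 \<and> (\<forall>n>u. real (?N n S) = poly p (real n))"
    if "S \<in> ?U" for S
  proof (rule less.hyps)
    show "card (?E - S) < card (?E - T)"
      by (rule psubset_card_mono) (use that fin in auto)
    show "S \<subseteq> ?E" "linked u S"
      using that linked_mono[OF less.prems(2)] by auto
  qed
  then have "\<forall>S\<in>?U. \<exists>p :: real poly. degree p \<le> u div 2 \<and> (\<forall>n>u. real (?N n S) = poly p (real n))"
    by (rule ballI)
  from bchoice[OF this] obtain q :: "_ \<Rightarrow> real poly" where
    q: "\<forall>S\<in>?U. degree (q S) \<le> u div 2 \<and> (\<forall>n>u. real (?N n S) = poly (q S) (real n))"
    ..
  obtain p :: "real poly" where p: "degree p \<le> u div 2"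
    "\<And>n. n > u \<Longrightarrow> real (card {k \<in> {..<u} \<rightarrow>\<^sub>E {1..n}. T \<subseteq> adjacency n u k}) = poly p (real n)"
    using card_adjacency_superset_poly[OF less.prems] by blast
  have "real (?N n T) = poly (p - sum q ?U) (real n)" if n: "n > u" for n
  proof -
    have ins: "{S. T \<subseteq> S \<and> S \<subseteq> ?E} = insert T ?U"
      using less.prems(1) by auto
    have "{k \<in> {..<u} \<rightarrow>\<^sub>E {1..n}. T \<subseteq> adjacency n u k}
        = (\<Union>S\<in>insert T ?U. {k \<in> {..<u} \<rightarrow>\<^sub>E {1..n}. adjacency n u k = S})"
      unfolding ins[symmetric] using adjacency_subset[of n u] by auto
    also have "card \<dots> = (\<Sum>S\<in>insert T ?U. ?N n S)"
    proof (rule card_UN_disjoint)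
      have "finite ({..<u} \<rightarrow>\<^sub>E {1..n})"
        by (intro finite_PiE) auto
      then show "\<forall>S\<in>insert T ?U. finite {k \<in> {..<u} \<rightarrow>\<^sub>E {1..n}. adjacency n u k = S}"
        by simp
    qed (use finU in auto)
    also have "\<dots> = ?N n T + (\<Sum>S\<in>?U. ?N n S)"
      using finU by simp
    finally have "poly p (real n) = real (?N n T) + (\<Sum>S\<in>?U. real (?N n S))"
      using p(2)[OF n] by simp
    also have "(\<Sum>S\<in>?U. real (?N n S)) = poly (sum q ?U) (real n)"
      unfolding poly_sum by (rule sum.cong) (use q n in auto)
    finally show ?thesis by simp
  qed
  moreover have "degree (p - sum q ?U) \<le> u div 2"
    using q by (intro degree_diff_le p degree_sum_le finU) blast
  ultimately show ?case by blast
qed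

section \<open>Moments of the linking number\<close>

text \<open>Two comparisons instead of the sign of a difference: subtraction on naturals truncates,
  and dependence on the order alone becomes immediate.\<close>

definition cmp_sign :: "nat \<Rightarrow> nat \<Rightarrow> real" where
  "cmp_sign a b = of_bool (b < a) - of_bool (a < b)"

text \<open>The index \<open>(i, c, s)\<close> refers to the \<open>i\<close>-th factor of the \<open>u\<close>-th power; \<open>c\<close> selects the second
  component of the link and \<open>s\<close> the cyclic successor.\<close>

definition grid_pos :: "nat \<Rightarrow> (nat \<Rightarrow> nat) \<Rightarrow> (nat \<Rightarrow> nat) \<Rightarrow> nat \<times> bool \<times> bool \<Rightarrow> nat" where
  "grid_pos n k l = (\<lambda>(i, c, s). if c then n + step n s (l i) else step n s (k i))"

text \<open>Without ties the value is 2 or -2 when the vertical edge of the second component lies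
  between the ends of the horizontal edge of the first, according to the latter's direction, and 0
  otherwise.\<close>

definition x_factor :: "(nat \<times> bool \<times> bool \<Rightarrow> nat) \<Rightarrow> nat \<Rightarrow> real" where
  "x_factor w i = cmp_sign (w (i, False, True)) (w (i, True, False))
                - cmp_sign (w (i, False, False)) (w (i, True, False))"

definition y_factor :: "(nat \<times> bool \<times> bool \<Rightarrow> nat) \<Rightarrow> nat \<Rightarrow> real" where
  "y_factor w i = cmp_sign (w (i, False, True)) (w (i, True, True))
                - cmp_sign (w (i, False, True)) (w (i, True, False))"

lemma step_range: "a \<in> {1..n} \<Longrightarrow> step n s a \<in> {1..n}"
  by (auto simp: step_def cyc_succ_def)

lemma cyc_succ_inj: "a \<in> {1..n} \<Longrightarrow> b \<in> {1..n} \<Longrightarrow> cyc_succ n a = cyc_succ n b \<longleftrightarrow> a = b"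
  by (auto simp: cyc_succ_def)

lemma grid_pos_range:
  assumes "k i \<in> {1..n}" "l i \<in> {1..n}"
  shows "grid_pos n k l (i, c, s) \<in> {1..2 * n}"
  using step_range[OF assms(1), of s] step_range[OF assms(2), of s] by (auto simp: grid_pos_def)

text \<open>Positions of the first component are at most \<open>n\<close>, those of the second
  exceed \<open>n\<close>, so there are no ties. Each factor is then 0, 2 or -2, hence the division
  by 4.\<close>

lemma grid_eps_eq_factors:
  assumes "\<sigma> permutes {1..2 * n}" "\<pi> permutes {1..2 * n}" "k i \<in> {1..n}" "l i \<in> {1..n}"
  shows "real_of_int (grid_eps n \<sigma> \<pi> (k i) (l i))
       = x_factor (\<sigma> \<circ> grid_pos n k l) i * y_factor (\<pi> \<circ> grid_pos n k l) i / 4"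
proof -
  have neq: "f (step n s (k i)) \<noteq> f (n + step n t (l i))" if "f permutes {1..2 * n}" for f s t
  proof -
    have "step n s (k i) \<noteq> n + step n t (l i)"
      using step_range[OF assms(3), of s] step_range[OF assms(4), of t] by simp
    then show ?thesis
      using permutes_inj[OF that] by (simp add: inj_eq)
  qed
  have x: "\<sigma> (k i) \<noteq> \<sigma> (n + l i)" "\<sigma> (cyc_succ n (k i)) \<noteq> \<sigma> (n + l i)"
    using neq[OF assms(1), of False False] neq[OF assms(1), of True False] by (simp_all add: step_def)
  have y: "\<pi> (cyc_succ n (k i)) \<noteq> \<pi> (n + l i)" "\<pi> (cyc_succ n (k i)) \<noteq> \<pi> (n + cyc_succ n (l i))"
    using neq[OF assms(2), of True False] neq[OF assms(2), of True True] by (simp_all add: step_def)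
  have *: "real_of_int (if a < x \<and> x < b \<and> r < y \<and> y < q \<or> b < x \<and> x < a \<and> q < y \<and> y < r then 1
      else if a < x \<and> x < b \<and> q < y \<and> y < r \<or> b < x \<and> x < a \<and> r < y \<and> y < q then -1 else 0)
    = (cmp_sign b x - cmp_sign a x) * (cmp_sign y r - cmp_sign y q) / 4"
    if "a \<noteq> x" "b \<noteq> x" "y \<noteq> q" "y \<noteq> r" for a b x y q r :: nat
  proof -
    \<comment> \<open>Without ties everything depends on four truth values, leaving sixteen
      cases.\<close>
    have "x < a \<longleftrightarrow> \<not> a < x" "x < b \<longleftrightarrow> \<not> b < x" "q < y \<longleftrightarrow> \<not> y < q" "r < y \<longleftrightarrow> \<not> y < r"
      using that by auto
    then show ?thesis
      by (cases "a < x"; cases "b < x"; cases "y < q"; cases "y < r") (simp_all add: cmp_sign_def)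
  qed
  show ?thesis
    using *[OF x y] by (simp add: grid_eps_def Let_def x_factor_def y_factor_def grid_pos_def step_def)
qed

definition x_avg :: "nat \<Rightarrow> nat \<Rightarrow> (nat \<Rightarrow> nat) \<Rightarrow> (nat \<Rightarrow> nat) \<Rightarrow> real" where
  "x_avg n u k l = perm_avg (2 * n) (\<lambda>\<sigma>. \<Prod>i<u. x_factor (\<sigma> \<circ> grid_pos n k l) i)"

definition y_avg :: "nat \<Rightarrow> nat \<Rightarrow> (nat \<Rightarrow> nat) \<Rightarrow> (nat \<Rightarrow> nat) \<Rightarrow> real" where
  "y_avg n u k l = perm_avg (2 * n) (\<lambda>\<pi>. \<Prod>i<u. y_factor (\<pi> \<circ> grid_pos n k l) i)"

section \<open>The moment as a sum of products of averages\<close>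

lemma pair_pmf_of_set:
  assumes "finite A" "A \<noteq> {}" "finite B" "B \<noteq> {}"
  shows "pair_pmf (pmf_of_set A) (pmf_of_set B) = pmf_of_set (A \<times> B)"
proof (rule pmf_eqI)
  fix z
  show "pmf (pair_pmf (pmf_of_set A) (pmf_of_set B)) z = pmf (pmf_of_set (A \<times> B)) z"
    using assms by (cases z) (simp add: pmf_pair indicator_def card_cartesian_product)
qed

lemma lk_moment_eq_perm_avg:
  "lk_moment n u = perm_avg (2 * n) (\<lambda>\<sigma>. perm_avg (2 * n) (\<lambda>\<pi>.
     real_of_int (\<Sum>k = 1..n. \<Sum>l = 1..n. grid_eps n \<sigma> \<pi> k l) ^ u))"
proof -
  let ?P = "{\<sigma>. \<sigma> permutes {1..2 * n}}"
  have P: "finite ?P" "?P \<noteq> {}" "card ?P = fact (2 * n)"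
    by (auto simp: finite_permutations card_permutations intro: exI[of _ id])
  have pair: "pair_pmf (pmf_of_set ?P) (pmf_of_set ?P) = pmf_of_set (?P \<times> ?P)"
    using P(1,2) P(1,2) by (rule pair_pmf_of_set)
  have "lk_moment n u = (\<Sum>(\<sigma>, \<pi>)\<in>?P \<times> ?P. real_of_int (linking_number (grid_link n \<sigma> \<pi>)) ^ u)
      / (fact (2 * n) * fact (2 * n))"
    unfolding lk_moment_def random_grid_link_def pair integral_map_pmf
    using P by (subst integral_pmf_of_set) (auto simp: case_prod_unfold card_cartesian_product)
  also have "\<dots> = (\<Sum>(\<sigma>, \<pi>)\<in>?P \<times> ?P.
      real_of_int (\<Sum>k = 1..n. \<Sum>l = 1..n. grid_eps n \<sigma> \<pi> k l) ^ u) / (fact (2 * n) * fact (2 * n))"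
    by (intro arg_cong2[of _ _ _ _ "(/)"] sum.cong refl)
      (clarsimp simp: linking_number_grid_link permutes_inj)
  finally show ?thesis
    by (simp add: perm_avg_def sum.cartesian_product[symmetric] sum_divide_distrib)
qed

text \<open>After expansion of the power, each term is a function of \<sigma> times a function of
  \<pi>, and the double average splits by independence.\<close>

lemma lk_moment_eq_sum_avg:
  "lk_moment n u = (1 / 4) ^ u *
     (\<Sum>k \<in> {..<u} \<rightarrow>\<^sub>E {1..n}. \<Sum>l \<in> {..<u} \<rightarrow>\<^sub>E {1..n}. x_avg n u k l * y_avg n u k l)"
proof -
  let ?K = "{..<u} \<rightarrow>\<^sub>E {1..n}"
  have pow: "real_of_int (\<Sum>k = 1..n. \<Sum>l = 1..n. grid_eps n \<sigma> \<pi> k l) ^ u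
      = (\<Sum>k\<in>?K. \<Sum>l\<in>?K. (1 / 4) ^ u * ((\<Prod>i<u. x_factor (\<sigma> \<circ> grid_pos n k l) i)
          * (\<Prod>i<u. y_factor (\<pi> \<circ> grid_pos n k l) i)))"
    if "\<sigma> permutes {1..2 * n}" "\<pi> permutes {1..2 * n}" for \<sigma> \<pi>
  proof -
    have "real_of_int (\<Sum>k = 1..n. \<Sum>l = 1..n. grid_eps n \<sigma> \<pi> k l) ^ u
        = (\<Prod>i<u. \<Sum>k\<in>{1..n}. \<Sum>l\<in>{1..n}. real_of_int (grid_eps n \<sigma> \<pi> k l))"
      by simp
    \<comment> \<open>Distributes the product over the sums in \<open>k\<close> and then in
      \<open>l\<close>, choosing one index pair per factor.\<close>
    also have "\<dots> = (\<Sum>k\<in>?K. \<Sum>l\<in>?K. \<Prod>i<u. real_of_int (grid_eps n \<sigma> \<pi> (k i) (l i)))"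
      by (simp only: prod_sum_PiE finite_lessThan finite_atLeastAtMost)
    also have "\<dots> = (\<Sum>k\<in>?K. \<Sum>l\<in>?K. \<Prod>i<u. 1 / 4 * (x_factor (\<sigma> \<circ> grid_pos n k l) i
        * y_factor (\<pi> \<circ> grid_pos n k l) i))"
    proof (intro sum.cong prod.cong refl)
      fix k l i assume "k \<in> ?K" "l \<in> ?K" "i \<in> {..<u}"
      then have "k i \<in> {1..n}" "l i \<in> {1..n}"
        by (meson PiE_mem)+
      from grid_eps_eq_factors[OF that, of k i l, OF this]
      show "real_of_int (grid_eps n \<sigma> \<pi> (k i) (l i))
          = 1 / 4 * (x_factor (\<sigma> \<circ> grid_pos n k l) i * y_factor (\<pi> \<circ> grid_pos n k l) i)"
        by simp
    qed
    finally show ?thesis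
      by (simp only: prod.distrib prod_constant card_lessThan)
  qed
  have "lk_moment n u = perm_avg (2 * n) (\<lambda>\<sigma>. perm_avg (2 * n) (\<lambda>\<pi>.
      \<Sum>k\<in>?K. \<Sum>l\<in>?K. (1 / 4) ^ u * ((\<Prod>i<u. x_factor (\<sigma> \<circ> grid_pos n k l) i)
          * (\<Prod>i<u. y_factor (\<pi> \<circ> grid_pos n k l) i))))"
    unfolding lk_moment_eq_perm_avg by (intro perm_avg_cong pow)
  then show ?thesis
    by (simp only: perm_avg_sum perm_avg_cmult perm_avg_mult_const x_avg_def y_avg_def sum_distrib_left)
qed

section \<open>Vanishing averages\<close>

lemma cmp_sign_reverse:
  "a \<in> {1..N} \<Longrightarrow> b \<in> {1..N} \<Longrightarrow> cmp_sign (N + 1 - a) (N + 1 - b) = - cmp_sign a b"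
  by (auto simp: cmp_sign_def)

text \<open>Reversing the values negates every comparison, hence each of the \<open>u\<close>
  factors, and \<open>u\<close> is odd.\<close>

lemma x_avg_odd:
  assumes "odd u" "k \<in> {..<u} \<rightarrow>\<^sub>E {1..n}" "l \<in> {..<u} \<rightarrow>\<^sub>E {1..n}"
  shows "x_avg n u k l = 0"
proof -
  define \<rho> where "\<rho> a = (if a \<in> {1..2 * n} then 2 * n + 1 - a else a)" for a
  have \<rho>: "\<rho> permutes {1..2 * n}"
    by (rule inj_imp_permutes) (auto simp: \<rho>_def inj_on_def)
  have "x_factor (\<rho> \<circ> \<sigma> \<circ> grid_pos n k l) i = - x_factor (\<sigma> \<circ> grid_pos n k l) i"
    if \<sigma>: "\<sigma> permutes {1..2 * n}" and i: "i < u" for \<sigma> i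
  proof -
    have \<sigma>_range: "\<sigma> (grid_pos n k l (i, c, s)) \<in> {1..2 * n}" for c s
      using grid_pos_range[of k i n l c s] PiE_mem[OF assms(2)] PiE_mem[OF assms(3)] i
        permutes_in_image[OF \<sigma>] by (simp del: atLeastAtMost_iff)
    then have "cmp_sign (\<rho> (\<sigma> (grid_pos n k l (i, c, s)))) (\<rho> (\<sigma> (grid_pos n k l (i, d, t))))
        = - cmp_sign (\<sigma> (grid_pos n k l (i, c, s))) (\<sigma> (grid_pos n k l (i, d, t)))" for c d s t
      using cmp_sign_reverse[OF \<sigma>_range \<sigma>_range] by (simp only: \<rho>_def if_True)
    then show ?thesis
      by (simp add: x_factor_def)
  qed
  then have "(\<Prod>i<u. x_factor (\<rho> \<circ> \<sigma> \<circ> grid_pos n k l) i) = - (\<Prod>i<u. x_factor (\<sigma> \<circ> grid_pos n k l) i)"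
    if "\<sigma> permutes {1..2 * n}" for \<sigma>
    using that \<open>odd u\<close> by (simp add: prod_uminus)
  then have "x_avg n u k l = - x_avg n u k l"
    unfolding x_avg_def perm_avg_minus[symmetric]
    by (subst perm_avg_compose_left[OF \<rho>, symmetric]) (rule perm_avg_cong)
  then show ?thesis by simp
qed

text \<open>Equal successors come from equal positions, so an isolated index shares neither of its
  two positions with another index.\<close>

lemma not_linkedD:
  assumes "\<not> linked u (adjacency n u k)" "k \<in> {..<u} \<rightarrow>\<^sub>E {1..n}"
  obtains i where "i < u"
    "\<And>j s t. j < u \<Longrightarrow> j \<noteq> i \<Longrightarrow> step n s (k j) \<noteq> step n t (k i)"
proof -
  obtain i where i: "i < u" "\<And>j s. j < u \<Longrightarrow> j \<noteq> i \<Longrightarrow>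
      (i, j, s) \<notin> adjacency n u k \<and> (j, i, s) \<notin> adjacency n u k"
    using assms(1) unfolding linked_def by blast
  have "step n s (k j) \<noteq> step n t (k i)" if j: "j < u" "j \<noteq> i" for j s t
  proof -
    have *: "k j \<noteq> k i" "k j \<noteq> cyc_succ n (k i)" "k i \<noteq> cyc_succ n (k j)"
      using i(2)[OF j, of False] i(2)[OF j, of True] i(1) j by (auto simp: adjacency_def step_def)
    moreover have "k j \<in> {1..n}" "k i \<in> {1..n}"
      using PiE_mem[OF assms(2)] i(1) j(1) by blast+
    ultimately show ?thesis
      using cyc_succ_inj[of "k j" n "k i"] by (auto simp: step_def simp del: atLeastAtMost_iff)
  qed
  with i(1) show ?thesis
    using that by blast
qed

text \<open>Transposing the two positions of an isolated index \<open>i\<close> negates factor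
  \<open>i\<close> and fixes every position in the other factors. For \<open>n = 1\<close> the
  transposition is the identity and the factor is 0.\<close>

lemma x_avg_not_linked:
  assumes "\<not> linked u (adjacency n u k)" "k \<in> {..<u} \<rightarrow>\<^sub>E {1..n}" "l \<in> {..<u} \<rightarrow>\<^sub>E {1..n}"
  shows "x_avg n u k l = 0"
proof -
  obtain i where i: "i < u" "\<And>j s t. j < u \<Longrightarrow> j \<noteq> i \<Longrightarrow> step n s (k j) \<noteq> step n t (k i)"
    using not_linkedD[OF assms(1,2)] by blast
  define \<tau> where "\<tau> = Transposition.transpose (step n False (k i)) (step n True (k i))"
  have k_range: "step n s (k j) \<in> {1..n}" and l_range: "step n s (l j) \<in> {1..n}" if "j < u" for j s
    using PiE_mem[OF assms(2)] PiE_mem[OF assms(3)] that by (blast intro: step_range)+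
  have "\<tau> permutes {1..2 * n}"
    unfolding \<tau>_def using k_range[OF i(1), of False] k_range[OF i(1), of True]
    by (intro permutes_swap_id) auto
  moreover have \<tau>_l: "\<tau> (n + step n s (l j)) = n + step n s (l j)" if "j < u" for j s
    unfolding \<tau>_def using k_range[OF i(1), of False] k_range[OF i(1), of True] l_range[OF that, of s]
    by (intro transpose_apply_other) auto
  moreover have \<tau>_k: "\<tau> (step n s (k j)) = step n s (k j)" if "j < u" "j \<noteq> i" for j s
    unfolding \<tau>_def using i(2)[OF that] by (intro transpose_apply_other)
  moreover have "\<tau> (step n False (k i)) = step n True (k i)" "\<tau> (step n True (k i)) = step n False (k i)"
    by (simp_all add: \<tau>_def)
  ultimately show ?thesis
    unfolding x_avg_def using i(1)
    by (intro perm_avg_prod_eq_0[of \<tau> _ _ i]) (simp_all add: x_factor_def grid_pos_def)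
qed

text \<open>Here the two positions to exchange belong to the second component: a y-factor compares
  one value of the first component with two consecutive values of the second.\<close>

lemma y_avg_not_linked:
  assumes "\<not> linked u (adjacency n u l)" "k \<in> {..<u} \<rightarrow>\<^sub>E {1..n}" "l \<in> {..<u} \<rightarrow>\<^sub>E {1..n}"
  shows "y_avg n u k l = 0"
proof -
  obtain i where i: "i < u" "\<And>j s t. j < u \<Longrightarrow> j \<noteq> i \<Longrightarrow> step n s (l j) \<noteq> step n t (l i)"
    using not_linkedD[OF assms(1,3)] by blast
  define \<tau> where "\<tau> = Transposition.transpose (n + step n False (l i)) (n + step n True (l i))"
  have k_range: "step n s (k j) \<in> {1..n}" and l_range: "step n s (l j) \<in> {1..n}" if "j < u" for j s
    using PiE_mem[OF assms(2)] PiE_mem[OF assms(3)] that by (blast intro: step_range)+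
  have "\<tau> permutes {1..2 * n}"
    unfolding \<tau>_def using l_range[OF i(1), of False] l_range[OF i(1), of True]
    by (intro permutes_swap_id) auto
  moreover have \<tau>_k: "\<tau> (step n s (k j)) = step n s (k j)" if "j < u" for j s
    unfolding \<tau>_def using l_range[OF i(1), of False] l_range[OF i(1), of True] k_range[OF that, of s]
    by (intro transpose_apply_other) auto
  moreover have \<tau>_l: "\<tau> (n + step n s (l j)) = n + step n s (l j)" if "j < u" "j \<noteq> i" for j s
    unfolding \<tau>_def using i(2)[OF that] by (intro transpose_apply_other) simp_all
  moreover have "\<tau> (n + step n False (l i)) = n + step n True (l i)"
    "\<tau> (n + step n True (l i)) = n + step n False (l i)"
    by (simp_all add: \<tau>_def)
  ultimately show ?thesis
    unfolding y_avg_def using i(1)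
    by (intro perm_avg_prod_eq_0[of \<tau> _ _ i]) (simp_all add: y_factor_def grid_pos_def)
qed

section \<open>Averages depend only on the adjacency systems\<close>

lemma order_invariant_on_factors:
  "order_invariant_on ({..<u} \<times> UNIV) (\<lambda>w. \<Prod>i<u. x_factor w i)"
  "order_invariant_on ({..<u} \<times> UNIV) (\<lambda>w. \<Prod>i<u. y_factor w i)"
proof -
  have cmp: "cmp_sign (v (i, c, s)) (v (i, d, t)) = cmp_sign (w (i, c, s)) (w (i, d, t))"
    if "\<forall>a\<in>{..<u} \<times> UNIV. \<forall>b\<in>{..<u} \<times> UNIV. v a < v b \<longleftrightarrow> w a < w b" "i < u"
    for v w :: "nat \<times> bool \<times> bool \<Rightarrow> nat" and i c s d t
  proof -
    have "v (i, c, s) < v (i, d, t) \<longleftrightarrow> w (i, c, s) < w (i, d, t)"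
      "v (i, d, t) < v (i, c, s) \<longleftrightarrow> w (i, d, t) < w (i, c, s)"
      using that by blast+
    then show ?thesis
      by (simp add: cmp_sign_def)
  qed
  show "order_invariant_on ({..<u} \<times> UNIV) (\<lambda>w. \<Prod>i<u. x_factor w i)"
    unfolding order_invariant_on_def x_factor_def
    by (intro allI impI prod.cong refl arg_cong2[of _ _ _ _ minus] cmp) simp_all
  show "order_invariant_on ({..<u} \<times> UNIV) (\<lambda>w. \<Prod>i<u. y_factor w i)"
    unfolding order_invariant_on_def y_factor_def
    by (intro allI impI prod.cong refl arg_cong2[of _ _ _ _ minus] cmp) simp_all
qed

text \<open>Injectivity of the cyclic successor reduces the case of two successors to plain
  equality, so the recorded equations decide all four cases.\<close>

lemma step_eq_iff_adjacency:
  assumes "k \<in> {..<u} \<rightarrow>\<^sub>E {1..n}" "i < u" "j < u"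
  shows "step n s (k i) = step n t (k j) \<longleftrightarrow>
    (if s = t then (i, j, False) \<in> adjacency n u k
     else if s then (i, j, True) \<in> adjacency n u k else (j, i, True) \<in> adjacency n u k)"
proof -
  have "k i \<in> {1..n}" "k j \<in> {1..n}"
    using PiE_mem[OF assms(1)] assms(2,3) by blast+
  then have "cyc_succ n (k i) = cyc_succ n (k j) \<longleftrightarrow> k i = k j"
    by (rule cyc_succ_inj)
  then show ?thesis
    using assms(2,3) eq_commute[of "k i" "k j"] eq_commute[of "k j" "cyc_succ n (k i)"]
    by (cases s; cases t) (simp_all only: step_def adjacency_def mem_Collect_eq prod.case if_True if_False
        simp_thms bool_simps)
qed

text \<open>Positions of different components never coincide, and within a component the adjacency
  system decides coincidence. So both position maps have the same coincidences, even for different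
  \<open>n\<close>.\<close>

lemma avg_cong_adjacency:
  assumes k: "k \<in> {..<u} \<rightarrow>\<^sub>E {1..n}" and l: "l \<in> {..<u} \<rightarrow>\<^sub>E {1..n}"
    and k': "k' \<in> {..<u} \<rightarrow>\<^sub>E {1..n'}" and l': "l' \<in> {..<u} \<rightarrow>\<^sub>E {1..n'}"
    and eq: "adjacency n u k = adjacency n' u k'" "adjacency n u l = adjacency n' u l'"
  shows "x_avg n u k l = x_avg n' u k' l'" "y_avg n u k l = y_avg n' u k' l'"
proof -
  let ?I = "{..<u} \<times> (UNIV :: (bool \<times> bool) set)"
  have fin: "finite ?I"
    by simp
  have range: "grid_pos m f g ` ?I \<subseteq> {1..2 * m}"
    if "f \<in> {..<u} \<rightarrow>\<^sub>E {1..m}" "g \<in> {..<u} \<rightarrow>\<^sub>E {1..m}" for f g m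
  proof (rule image_subsetI)
    fix a assume "a \<in> ?I"
    then obtain i c s where a: "a = (i, c, s)" "i < u"
      by auto
    then show "grid_pos m f g a \<in> {1..2 * m}"
      unfolding a(1) using PiE_mem[OF that(1)] PiE_mem[OF that(2)] by (blast intro: grid_pos_range)
  qed
  have neq: "step m s (f i) \<noteq> m + step m t (g j)"
    if "f \<in> {..<u} \<rightarrow>\<^sub>E {1..m}" "g \<in> {..<u} \<rightarrow>\<^sub>E {1..m}" "i < u" "j < u" for f g m i j s t
  proof -
    have "f i \<in> {1..m}" "g j \<in> {1..m}"
      using PiE_mem[OF that(1)] PiE_mem[OF that(2)] that(3,4) by blast+
    then show ?thesis
      using step_range[of "f i" m s] step_range[of "g j" m t] by simp
  qed
  have ker: "grid_pos n k l a = grid_pos n k l b \<longleftrightarrow> grid_pos n' k' l' a = grid_pos n' k' l' b"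
    if ab: "a \<in> ?I" "b \<in> ?I" for a b
  proof -
    obtain i c s j d t where "a = (i, c, s)" "b = (j, d, t)" "i < u" "j < u"
      using ab by auto
    then show ?thesis
      using neq[OF k l, of i j s t] neq[OF k' l', of i j s t] neq[OF k l, of j i t s]
        neq[OF k' l', of j i t s] step_eq_iff_adjacency[OF k, of i j s t]
        step_eq_iff_adjacency[OF l, of i j s t] step_eq_iff_adjacency[OF k', of i j s t]
        step_eq_iff_adjacency[OF l', of i j s t] eq
      by (cases c; cases d) (simp_all add: grid_pos_def)
  qed
  show "x_avg n u k l = x_avg n' u k' l'" "y_avg n u k l = y_avg n' u k' l'"
    unfolding x_avg_def y_avg_def
    by (rule perm_avg_order_invariant_eq[OF fin _ range[OF k l] range[OF k' l'] ker];
        simp add: order_invariant_on_factors)+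
qed

text \<open>The point is that \<open>G\<close> does not depend on \<open>n\<close>: all of that
  dependence is left to the counts of index functions.\<close>

lemma ex_avg_as_function_of_adjacency:
  "\<exists>G. (\<forall>n. \<forall>k \<in> {..<u} \<rightarrow>\<^sub>E {1..n}. \<forall>l \<in> {..<u} \<rightarrow>\<^sub>E {1..n}.
      x_avg n u k l * y_avg n u k l = G (adjacency n u k) (adjacency n u l))
    \<and> (\<forall>S T. \<not> (linked u S \<and> linked u T) \<longrightarrow> G S T = 0)"
proof -
  define W where "W n k l = x_avg n u k l * y_avg n u k l" for n k l
  define realizes where "realizes S T n k l \<longleftrightarrow> k \<in> {..<u} \<rightarrow>\<^sub>E {1..n} \<and> l \<in> {..<u} \<rightarrow>\<^sub>E {1..n}
      \<and> adjacency n u k = S \<and> adjacency n u l = T" for S T n k l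
  \<comment> \<open>Any realization gives the same value. The default 0 agrees with the vanishing
    averages; a linked pair without realization gets an arbitrary value, but its counts have product
    0 for every \<open>n\<close>.\<close>
  define G where "G S T = (if linked u S \<and> linked u T
      then SOME w. \<exists>n k l. realizes S T n k l \<and> w = W n k l else 0)" for S T
  have W_eq: "W n k l = G S T" if r: "realizes S T n k l" for S T k l and n :: nat
  proof (cases "linked u S \<and> linked u T")
    case True
    have "\<exists>n k l. realizes S T n k l \<and> G S T = W n k l"
      using True r unfolding G_def by (simp, intro someI_ex[of "\<lambda>w. \<exists>n k l. realizes S T n k l \<and> w = W n k l"]) blast
    then obtain n' k' l' where "realizes S T n' k' l'" "G S T = W n' k' l'"
      by blast
    then show ?thesis
      using r avg_cong_adjacency[of k u n l k' n' l'] by (simp add: realizes_def W_def)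
  next
    case False
    then show ?thesis
      using r x_avg_not_linked[of u n k l] y_avg_not_linked[of u n l k]
      by (auto simp: realizes_def W_def G_def)
  qed
  show ?thesis
  proof (intro exI[of _ G] conjI allI ballI impI)
    fix n :: nat and k l :: "nat \<Rightarrow> nat"
    assume "k \<in> {..<u} \<rightarrow>\<^sub>E {1..n}" "l \<in> {..<u} \<rightarrow>\<^sub>E {1..n}"
    then show "x_avg n u k l * y_avg n u k l = G (adjacency n u k) (adjacency n u l)"
      using W_eq by (simp add: realizes_def W_def)
  next
    fix S T assume "\<not> (linked u S \<and> linked u T)"
    then show "G S T = 0"
      by (auto simp: G_def)
  qed
qed

theorem theorem1p1:
  shows "(\<forall>u\<ge>1. \<exists>p :: real poly. degree p \<le> u \<and> (\<forall>n>u. lk_moment n u = poly p (real n)))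
       \<and> (\<forall>u n. odd u \<and> n \<ge> 1 \<longrightarrow> lk_moment n u = 0)"
proof (intro conjI allI impI)
  fix u n :: nat assume "odd u \<and> n \<ge> 1"
  then show "lk_moment n u = 0"
    by (simp add: lk_moment_eq_sum_avg x_avg_odd del: One_nat_def)
next
  fix u :: nat
  let ?E = "{..<u} \<times> {..<u} \<times> (UNIV :: bool set)"
  let ?K = "\<lambda>n. {..<u} \<rightarrow>\<^sub>E {1..n::nat}"
  let ?N = "\<lambda>n T. real (card {k \<in> ?K n. adjacency n u k = T})"
  from ex_avg_as_function_of_adjacency[of u] obtain G where
    G: "(\<forall>n. \<forall>k \<in> ?K n. \<forall>l \<in> ?K n.
        x_avg n u k l * y_avg n u k l = G (adjacency n u k) (adjacency n u l))
      \<and> (\<forall>S T. \<not> (linked u S \<and> linked u T) \<longrightarrow> G S T = 0)" ..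
  then have G0: "G S T = 0" if "\<not> (linked u S \<and> linked u T)" for S T
    using that by blast
  have "\<forall>T\<in>{T \<in> Pow ?E. linked u T}. \<exists>p :: real poly. degree p \<le> u div 2 \<and> (\<forall>n>u. ?N n T = poly p (real n))"
    by (intro ballI card_adjacency_eq_poly) simp_all
  from bchoice[OF this] obtain P :: "_ \<Rightarrow> real poly" where
    P: "\<forall>T\<in>{T \<in> Pow ?E. linked u T}. degree (P T) \<le> u div 2 \<and> (\<forall>n>u. ?N n T = poly (P T) (real n))" ..
  \<comment> \<open>Groups the index functions by their exact systems and replaces each count by its
    polynomial.\<close>
  define p where
    "p = smult ((1 / 4) ^ u) (\<Sum>S\<in>Pow ?E. \<Sum>T\<in>Pow ?E. smult (G S T) (P S * P T))"
  \<comment> \<open>Two factors of degree at most \<open>u div 2\<close> suffice. If a system is not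
    linked its \<open>P\<close> is unspecified, but then the coefficient \<open>G S T\<close> is
    0.\<close>
  have deg: "degree (smult (G S T) (P S * P T)) \<le> u" if "S \<in> Pow ?E" "T \<in> Pow ?E" for S T
  proof (cases "linked u S \<and> linked u T")
    case True
    then have "degree (P S) \<le> u div 2" "degree (P T) \<le> u div 2"
      using P that by auto
    then show ?thesis
      using degree_mult_le[of "P S" "P T"] degree_smult_le[of "G S T" "P S * P T"] by linarith
  qed (simp add: G0)
  have "degree p \<le> u"
    unfolding p_def
    by (rule order.trans[OF degree_smult_le], intro degree_sum_le deg) simp_all
  moreover have "lk_moment n u = poly p (real n)" if n: "n > u" for n
  proof -
    have finK: "finite (?K n)"
      by (intro finite_PiE) auto
    have sub: "adjacency n u ` ?K n \<subseteq> Pow ?E"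
      using adjacency_subset by blast
    have "(\<Sum>k\<in>?K n. \<Sum>l\<in>?K n. x_avg n u k l * y_avg n u k l)
        = (\<Sum>k\<in>?K n. \<Sum>l\<in>?K n. G (adjacency n u k) (adjacency n u l))"
      using G by (intro sum.cong refl) blast
    \<comment> \<open>Collects the \<open>l\<close> with the same system; the next line does so for
      \<open>k\<close>.\<close>
    also have "\<dots> = (\<Sum>k\<in>?K n. \<Sum>T\<in>Pow ?E. ?N n T * G (adjacency n u k) T)"
      by (intro sum.cong refl sum_fun_comp finK sub) auto
    also have "\<dots> = (\<Sum>S\<in>Pow ?E. ?N n S * (\<Sum>T\<in>Pow ?E. ?N n T * G S T))"
      by (rule sum_fun_comp[OF finK _ sub]) auto
    also have "\<dots> = (\<Sum>S\<in>Pow ?E. \<Sum>T\<in>Pow ?E. poly (smult (G S T) (P S * P T)) (real n))"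
      unfolding sum_distrib_left
    proof (intro sum.cong refl)
      fix S T assume ST: "S \<in> Pow ?E" "T \<in> Pow ?E"
      show "?N n S * (?N n T * G S T) = poly (smult (G S T) (P S * P T)) (real n)"
      proof (cases "linked u S \<and> linked u T")
        case True
        then have "?N n S = poly (P S) (real n)" "?N n T = poly (P T) (real n)"
          using P ST n by blast+
        then show ?thesis by simp
      qed (simp add: G0)
    qed
    finally show ?thesis
      by (simp add: lk_moment_eq_sum_avg p_def poly_sum del: One_nat_def)
  qed
  ultimately show "\<exists>p :: real poly. degree p \<le> u \<and> (\<forall>n>u. lk_moment n u = poly p (real n))"
    by blast
qed

end
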